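(* Let $f\in\mathcal{S}(\Omega)$. If $x\in\Omega\cap\mathbb{R}$, then $\mathbb{S}_x=\{x\}$ is included either in both $V(f)$ and $V(f^c)$ or in neither of the two. If instead $x\in\Omega\setminus\mathbb{R}$, then one of the following properties holds: 1. $V(f)$ does not intersect $\mathbb{S}_x$; 2. $V(f)\cap\mathbb{S}_x=\{y\}$, $f'_s(x)$ is invertible and $y=\mathrm{Re}(x)-f^\circ_s(x)f'_s(x)^{-1}$; 3. $V(f)\cap\mathbb{S}_x=T_{y_1}$ for some $y_1\in\mathbb{S}_x\cap\mathbb{H}$ and $f'_s(x),f^\circ_s(x)\in\epsilon\mathbb{H}^*$; 4. $V(f)$ includes $\mathbb{S}_x$ and $f'_s(x)=f^\circ_s(x)=0$. In each of the aforementioned cases, respectively: 1. $V(f^c)$ does not intersect $\mathbb{S}_x$; 2. $V(f^c)\cap\mathbb{S}_x=\{\mathscr{C}(f'_s(x),y^c)\}$; 3. $V(f^c)\cap\mathbb{S}_x=T_{\mathscr{C}(f'_s(x),y_1^c)}$; 4. $V(f^c)$ includes $\mathbb{S}_x$.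
   Context: $\mathbb{H}$ is the algebra of quaternions, with conjugation $q\mapsto q^c$; $\mathrm{Im}(\mathbb{H})$ is the space of purely imaginary quaternions; $p\perp q$ means $pq^c+qp^c=0$; $\mathbb{H}^*=\mathbb{H}\setminus\{0\}$. The dual quaternions are $\mathbb{DH}=\mathbb{H}+\epsilon\mathbb{H}$, with elements $h=h_1+\epsilon h_2$ ($h_1,h_2\in\mathbb{H}$), componentwise addition and product $hh'=h_1h'_1+\epsilon(h_1h'_2+h_2h'_1)$; $h_1$ is the primal part of $h$ (a subscript $1$ denotes the primal part). Put $h^c=h_1^c+\epsilon h_2^c$, $t(h)=h+h^c$, $n(h)=hh^c$. Let $\mathbb{S}_{\mathbb{DH}}=\{J\in\mathbb{DH}: t(J)=0,\ n(J)=1\}$, and let $Q_{\mathbb{DH}}=\{\alpha+\beta J:\alpha,\beta\in\mathbb{R},\ J\in\mathbb{S}_{\mathbb{DH}}\}$. For $x=\alpha+\beta J\in Q_{\mathbb{DH}}$ put $\mathrm{Re}(x)=\alpha$, $\mathrm{Im}(x)=\beta J$, $x^c=\alpha-\beta J$ and $\mathbb{S}_x=\alpha+\beta\,\mathbb{S}_{\mathbb{DH}}$. For $x\in Q_{\mathbb{DH}}\setminus\mathbb{R}$, $T_{x_1}=\{x_1+\epsilon\gamma:\gamma\in\mathrm{Im}(\mathbb{H}),\ \gamma\perp\mathrm{Im}(x_1)\}\subset\mathbb{S}_x$. For $h,l\in\mathbb{DH}$, $\mathscr{C}(h,l)$ is defined as $h^{-1}lh$ if $h$ is invertible (i.e.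 $h_1\ne0$), $h_2^{-1}lh_2$ if $h=\epsilon h_2\in\epsilon\mathbb{H}^*$, and $l$ if $h=0$. Let $D\subseteq\mathbb{C}$ be invariant under complex conjugation and $\Omega=\Omega_D=\{\alpha+\beta J:\alpha,\beta\in\mathbb{R},\ \alpha+i\beta\in D,\ J\in\mathbb{S}_{\mathbb{DH}}\}\subseteq Q_{\mathbb{DH}}$. Let $\mathbb{DH}_{\mathbb{C}}=\mathbb{DH}\otimes_{\mathbb{R}}\mathbb{C}=\{a+\iota b: a,b\in\mathbb{DH}\}$, with $\iota^2=-1$, $\iota$ central, and $(a+\iota b)^c=a^c+\iota b^c$. A stem function is $F=F_1+\iota F_2:D\to\mathbb{DH}_{\mathbb{C}}$ with $F_1(\bar z)=F_1(z)$, $F_2(\bar z)=-F_2(z)$; it induces the slice function $f=\mathcal{I}(F):\Omega\to\mathbb{DH}$, $f(\alpha+\beta J)=F_1(\alpha+i\beta)+JF_2(\alpha+i\beta)$. $\mathcal{S}(\Omega)$ is the set of slice functions on $\Omega$. The slice conjugate is $f^c=\mathcal{I}(F^c)$ with $F^c(z)=F(z)^c$. The spherical value is $f^\circ_s(x)=\frac12(f(x)+f(x^c))$ and, for $x\in\Omega\setminus\mathbb{R}$, the spherical derivative is $f'_s(x)=\frac12\mathrm{Im}(x)^{-1}(f(x)-f(x^c))$. $V(f)=\{x\in\Omega: f(x)=0\}$ denotes the zero set. *)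

theory Defs
  imports Complex_Main
begin

section \<open>Quaternions\<close>

text \<open>\<open>Quat a b c d\<close> is \<open>a + b i + c j + d k\<close>.\<close>

codatatype quat = Quat (qRe: real) (qI: real) (qJ: real) (qK: real)

lemma quat_eq_iff: "p = q \<longleftrightarrow> qRe p = qRe q \<and> qI p = qI q \<and> qJ p = qJ q \<and> qK p = qK q"
  by (auto intro: quat.expand)

instantiation quat :: real_vector
begin

primcorec zero_quat where
  "qRe 0 = 0" | "qI 0 = 0" | "qJ 0 = 0" | "qK 0 = 0"

primcorec plus_quat where
  "qRe (p + q) = qRe p + qRe q"
| "qI (p + q) = qI p + qI q"
| "qJ (p + q) = qJ p + qJ q"
| "qK (p + q) = qK p + qK q"

primcorec uminus_quat where
  "qRe (- p) = - qRe p" | "qI (- p) = - qI p" | "qJ (- p) = - qJ p" | "qK (- p) = - qK p"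

primcorec minus_quat where
  "qRe (p - q) = qRe p - qRe q"
| "qI (p - q) = qI p - qI q"
| "qJ (p - q) = qJ p - qJ q"
| "qK (p - q) = qK p - qK q"

primcorec scaleR_quat where
  "qRe (scaleR r q) = r * qRe q"
| "qI (scaleR r q) = r * qI q"
| "qJ (scaleR r q) = r * qJ q"
| "qK (scaleR r q) = r * qK q"

instance
  by standard (auto simp: quat_eq_iff algebra_simps)

end

instantiation quat :: real_div_algebra
begin

primcorec one_quat where
  "qRe 1 = 1" | "qI 1 = 0" | "qJ 1 = 0" | "qK 1 = 0"

primcorec times_quat where
  "qRe (p * q) = qRe p * qRe q - qI p * qI q - qJ p * qJ q - qK p * qK q"
| "qI (p * q) = qRe p * qI q + qI p * qRe q + qJ p * qK q - qK p * qJ q"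
| "qJ (p * q) = qRe p * qJ q - qI p * qK q + qJ p * qRe q + qK p * qI q"
| "qK (p * q) = qRe p * qK q + qI p * qJ q - qJ p * qI q + qK p * qRe q"

primcorec inverse_quat where
  "qRe (inverse q) = qRe q / ((qRe q)\<^sup>2 + (qI q)\<^sup>2 + (qJ q)\<^sup>2 + (qK q)\<^sup>2)"
| "qI (inverse q) = - qI q / ((qRe q)\<^sup>2 + (qI q)\<^sup>2 + (qJ q)\<^sup>2 + (qK q)\<^sup>2)"
| "qJ (inverse q) = - qJ q / ((qRe q)\<^sup>2 + (qI q)\<^sup>2 + (qJ q)\<^sup>2 + (qK q)\<^sup>2)"
| "qK (inverse q) = - qK q / ((qRe q)\<^sup>2 + (qI q)\<^sup>2 + (qJ q)\<^sup>2 + (qK q)\<^sup>2)"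

definition "p div (q::quat) = p * inverse q"

lemma quat_norm_nz:
  assumes "q \<noteq> (0::quat)"
  shows "(qRe q)\<^sup>2 + (qI q)\<^sup>2 + (qJ q)\<^sup>2 + (qK q)\<^sup>2 > 0"
  using assms unfolding quat_eq_iff
  by (smt (verit) zero_quat.simps power2_eq_square zero_eq_power2 zero_le_power2)

instance
proof
  fix q :: quat
  assume q: "q \<noteq> 0"
  define N where "N = (qRe q)\<^sup>2 + (qI q)\<^sup>2 + (qJ q)\<^sup>2 + (qK q)\<^sup>2"
  have N: "N > 0" using quat_norm_nz[OF q] by (simp add: N_def)
  have 1: "qRe q * qRe q / N + qI q * qI q / N + qJ q * qJ q / N + qK q * qK q / N = 1"
    using N by (simp add: N_def power2_eq_square flip: add_divide_distrib)
  have inv: "qRe (inverse q) = qRe q / N" "qI (inverse q) = - qI q / N"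
    "qJ (inverse q) = - qJ q / N" "qK (inverse q) = - qK q / N"
    by (simp_all add: N_def)
  show "inverse q * q = 1" "q * inverse q = 1"
    using 1 by (simp_all add: quat_eq_iff inv algebra_simps del: inverse_quat.simps)
qed (auto simp: quat_eq_iff algebra_simps divide_quat_def)

end

primcorec qcnj :: "quat \<Rightarrow> quat" where
  "qRe (qcnj q) = qRe q" | "qI (qcnj q) = - qI q" | "qJ (qcnj q) = - qJ q" | "qK (qcnj q) = - qK q"

definition qIm :: "quat \<Rightarrow> quat" where
  "qIm q = Quat 0 (qI q) (qJ q) (qK q)"

definition imag_quats :: "quat set" where
  "imag_quats = {q. qRe q = 0}"

definition qorth :: "quat \<Rightarrow> quat \<Rightarrow> bool" where
  "qorth p q \<longleftrightarrow> p * qcnj q + q * qcnj p = 0"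


section \<open>Dual quaternions\<close>

text \<open>\<open>DQuat a b\<close> is \<open>a + \<epsilon> b\<close>.\<close>

codatatype dquat = DQuat (primal: quat) (dual: quat)

lemma dquat_eq_iff: "h = l \<longleftrightarrow> primal h = primal l \<and> dual h = dual l"
  by (auto intro: dquat.expand)

instantiation dquat :: real_algebra_1
begin

primcorec zero_dquat where
  "primal 0 = 0" | "dual 0 = 0"

primcorec one_dquat where
  "primal 1 = 1" | "dual 1 = 0"

primcorec plus_dquat where
  "primal (h + l) = primal h + primal l" | "dual (h + l) = dual h + dual l"

primcorec uminus_dquat where
  "primal (- h) = - primal h" | "dual (- h) = - dual h"

primcorec minus_dquat where
  "primal (h - l) = primal h - primal l" | "dual (h - l) = dual h - dual l"

primcorec scaleR_dquat where
  "primal (scaleR r h) = scaleR r (primal h)" | "dual (scaleR r h) = scaleR r (dual h)"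

primcorec times_dquat where
  "primal (h * l) = primal h * primal l"
| "dual (h * l) = primal h * dual l + dual h * primal l"

instance
  by standard (auto simp: dquat_eq_iff algebra_simps)

end

definition dq_of_quat :: "quat \<Rightarrow> dquat" where
  "dq_of_quat q = DQuat q 0"

definition dq_eps :: dquat where
  "dq_eps = DQuat 0 1"

lemma dquat_decomp: "DQuat a b = dq_of_quat a + dq_eps * dq_of_quat b"
  by (simp add: dquat_eq_iff dq_of_quat_def dq_eps_def)

text \<open>The set \<open>\<epsilon>\<H>\<^sup>*\<close>.\<close>

definition eps_quats :: "dquat set" where
  "eps_quats = {dq_eps * dq_of_quat q | q. q \<noteq> 0}"

definition dq_invertible :: "dquat \<Rightarrow> bool" where
  "dq_invertible h \<longleftrightarrow> (\<exists>k. h * k = 1 \<and> k * h = 1)"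

text \<open>The inverse is meaningful for invertible dual quaternions only; like in the rest of HOL, it
  is set to 0 elsewhere.\<close>

instantiation dquat :: inverse
begin

definition "inverse h = (if dq_invertible h then THE k::dquat. h * k = 1 \<and> k * h = 1 else 0)"

definition "h div (l::dquat) = h * inverse l"

instance ..

end

lemma dq_inverse_unique:
  fixes h k :: dquat
  assumes "h * k = 1" "k * h = 1"
  shows "inverse h = k"
proof -
  have "(THE k. h * k = 1 \<and> k * h = 1) = k"
    using assms by (intro the_equality) (auto, metis mult.assoc mult_1_left mult_1_right)
  moreover have "dq_invertible h"
    using assms unfolding dq_invertible_def by blast
  ultimately show ?thesis by (simp add: inverse_dquat_def)
qed

lemma dq_invertible_iff: "dq_invertible h \<longleftrightarrow> primal h \<noteq> 0"
proof
  assume "dq_invertible h"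
  then obtain k where "h * k = 1" by (auto simp: dq_invertible_def)
  hence "primal h * primal k = 1" by (metis times_dquat.simps(1) one_dquat.simps(1))
  thus "primal h \<noteq> 0" by auto
next
  assume "primal h \<noteq> 0"
  thus "dq_invertible h"
    unfolding dq_invertible_def
    by (intro exI[of _ "DQuat (inverse (primal h)) (- inverse (primal h) * dual h * inverse (primal h))"])
       (auto simp: dquat_eq_iff mult.assoc simp flip: mult.assoc[of "primal h" "inverse (primal h)"])
qed

primcorec dq_cnj :: "dquat \<Rightarrow> dquat" where
  "primal (dq_cnj h) = qcnj (primal h)" | "dual (dq_cnj h) = qcnj (dual h)"

definition dq_trace :: "dquat \<Rightarrow> dquat" where
  "dq_trace h = h + dq_cnj h"

definition dq_norm :: "dquat \<Rightarrow> dquat" where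
  "dq_norm h = h * dq_cnj h"

definition dq_units :: "dquat set" where
  "dq_units = {J. dq_trace J = 0 \<and> dq_norm J = 1}"

definition dq_cone :: "dquat set" where
  "dq_cone = {of_real \<alpha> + \<beta> *\<^sub>R J | \<alpha> \<beta> J. J \<in> dq_units}"

text \<open>Real and imaginary part are specified on \<^const>\<open>dq_cone\<close> through the decomposition
  \<open>x = \<alpha> + \<beta> J\<close>; see \<open>dq_Re_decomp\<close> and \<open>dq_Im_decomp\<close> for well-definedness. Conjugation on the
  cone, \<open>\<alpha> + \<beta> J \<mapsto> \<alpha> - \<beta> J\<close>, is the restriction of \<^const>\<open>dq_cnj\<close> (\<open>dq_cnj_decomp\<close>).\<close>

definition dq_Re :: "dquat \<Rightarrow> real" where
  "dq_Re x = (THE \<alpha>. \<exists>\<beta>. \<exists>J\<in>dq_units. x = of_real \<alpha> + \<beta> *\<^sub>R J)"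

definition dq_Im :: "dquat \<Rightarrow> dquat" where
  "dq_Im x = (THE v. \<exists>\<alpha> \<beta>. \<exists>J\<in>dq_units. x = of_real \<alpha> + \<beta> *\<^sub>R J \<and> v = \<beta> *\<^sub>R J)"

text \<open>\<open>\<S>\<^sub>x = \<alpha> + \<beta> \<S>\<close> for \<open>x = \<alpha> + \<beta> J\<close>. A point \<open>x\<close> has also the decomposition
  \<open>\<alpha> + (- \<beta>) (- J)\<close>, which gives the same set (\<open>dq_sphere_decomp\<close>).\<close>

definition dq_sphere :: "dquat \<Rightarrow> dquat set" where
  "dq_sphere x =
     {of_real \<alpha> + \<beta> *\<^sub>R I | \<alpha> \<beta> I. I \<in> dq_units \<and> (\<exists>J\<in>dq_units. x = of_real \<alpha> + \<beta> *\<^sub>R J)}"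

lemma primal_of_real [simp]: "primal (of_real a) = of_real a"
  and dual_of_real [simp]: "dual (of_real a) = 0"
  by (simp_all add: of_real_def)

lemma quat_of_real [simp]:
  "qRe (of_real a) = a" "qI (of_real a) = 0" "qJ (of_real a) = 0" "qK (of_real a) = 0"
  by (simp_all add: of_real_def)

lemma dq_units_cnj: "J \<in> dq_units \<Longrightarrow> dq_cnj J = - J"
  unfolding dq_units_def dq_trace_def by (simp add: eq_neg_iff_add_eq_0 add.commute)

lemma dq_units_uminus: "J \<in> dq_units \<Longrightarrow> - J \<in> dq_units"
  unfolding dq_units_def dq_trace_def dq_norm_def
  by (auto simp: dquat_eq_iff quat_eq_iff)

lemma dq_units_square: "J \<in> dq_units \<Longrightarrow> J * J = -1"
  using dq_units_cnj[of J] by (auto simp: dq_units_def dq_norm_def minus_equation_iff)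

lemma dq_units_qRe: "J \<in> dq_units \<Longrightarrow> qRe (primal J) = 0"
  unfolding dq_units_def dq_trace_def by (auto simp: dquat_eq_iff quat_eq_iff)

lemma dq_units_cancel:
  assumes "J \<in> dq_units" "J * a = J * b"
  shows "a = b"
proof -
  have "J * (J * a) = J * (J * b)" using assms by simp
  thus ?thesis using dq_units_square[OF assms(1)] by (simp flip: mult.assoc)
qed

lemma dq_units_ne: "dq_units \<noteq> {}"
proof -
  have "dq_of_quat (Quat 0 1 0 0) \<in> dq_units"
    by (simp add: dq_units_def dq_trace_def dq_norm_def dq_of_quat_def dquat_eq_iff quat_eq_iff)
  thus ?thesis by blast
qed

lemma dq_decomp_unique:
  assumes "of_real a + b *\<^sub>R J = of_real a' + b' *\<^sub>R J'" "J \<in> dq_units" "J' \<in> dq_units"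
  shows "a = a'" "b *\<^sub>R J = b' *\<^sub>R J'" "(b' = b \<and> (b = 0 \<or> J' = J)) \<or> (b' = - b \<and> J' = - J)"
proof -
  have "qRe (primal (of_real a + b *\<^sub>R J)) = qRe (primal (of_real a' + b' *\<^sub>R J'))"
    using assms(1) by simp
  thus a: "a = a'" using assms(2,3) by (simp add: dq_units_qRe)
  show bJ: "b *\<^sub>R J = b' *\<^sub>R J'" using assms(1) a by simp
  have "(b *\<^sub>R J) * (b *\<^sub>R J) = (b' *\<^sub>R J') * (b' *\<^sub>R J')" using bJ by simp
  hence "of_real (b * b) = (of_real (b' * b') :: dquat)"
    using assms(2,3) by (simp add: dq_units_square of_real_def)
  hence "b * b = b' * b'" using of_real_eq_iff by blast
  hence "b' = b \<or> b' = - b" by (metis square_eq_iff)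
  thus "(b' = b \<and> (b = 0 \<or> J' = J)) \<or> (b' = - b \<and> J' = - J)"
  proof
    assume "b' = b"
    thus ?thesis using bJ by auto
  next
    assume b': "b' = - b"
    show ?thesis
    proof (cases "b = 0")
      case False
      have "b *\<^sub>R J = b *\<^sub>R (- J')" using bJ b' by simp
      hence "J = - J'" using False by (simp only: scaleR_cancel_left simp_thms)
      thus ?thesis using b' by simp
    qed (use b' in auto)
  qed
qed

lemma dq_Re_decomp: "J \<in> dq_units \<Longrightarrow> dq_Re (of_real \<alpha> + \<beta> *\<^sub>R J) = \<alpha>"
  unfolding dq_Re_def by (rule the_equality) (blast, metis dq_decomp_unique(1))

lemma dq_Im_decomp: "J \<in> dq_units \<Longrightarrow> dq_Im (of_real \<alpha> + \<beta> *\<^sub>R J) = \<beta> *\<^sub>R J"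
  unfolding dq_Im_def by (rule the_equality) (blast, metis dq_decomp_unique(2))

lemma dq_cnj_decomp:
  assumes "J \<in> dq_units"
  shows "dq_cnj (of_real \<alpha> + \<beta> *\<^sub>R J) = of_real \<alpha> - \<beta> *\<^sub>R J"
proof -
  have "dq_cnj (of_real \<alpha> + \<beta> *\<^sub>R J) = of_real \<alpha> + \<beta> *\<^sub>R dq_cnj J"
    by (simp add: dquat_eq_iff quat_eq_iff)
  thus ?thesis by (simp add: dq_units_cnj[OF assms])
qed

lemma dq_sphere_decomp:
  assumes "J \<in> dq_units"
  shows "dq_sphere (of_real \<alpha> + \<beta> *\<^sub>R J) = {of_real \<alpha> + \<beta> *\<^sub>R I | I. I \<in> dq_units}"
proof (intro equalityI subsetI)
  fix y assume "y \<in> dq_sphere (of_real \<alpha> + \<beta> *\<^sub>R J)"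
  then obtain a b I J' where y: "y = of_real a + b *\<^sub>R I" "I \<in> dq_units" "J' \<in> dq_units"
    "of_real \<alpha> + \<beta> *\<^sub>R J = of_real a + b *\<^sub>R J'"
    unfolding dq_sphere_def by blast
  have "a = \<alpha>" "b = \<beta> \<or> b = - \<beta>"
    using dq_decomp_unique[OF y(4) assms y(3)] by auto
  hence "y = of_real \<alpha> + \<beta> *\<^sub>R I \<or> y = of_real \<alpha> + \<beta> *\<^sub>R (- I)"
    using y(1) by auto
  thus "y \<in> {of_real \<alpha> + \<beta> *\<^sub>R I | I. I \<in> dq_units}"
    using y(2) dq_units_uminus by blast
next
  fix y assume "y \<in> {of_real \<alpha> + \<beta> *\<^sub>R I | I. I \<in> dq_units}"
  thus "y \<in> dq_sphere (of_real \<alpha> + \<beta> *\<^sub>R J)"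
    unfolding dq_sphere_def using assms by blast
qed

text \<open>The set \<open>T\<^sub>p\<close> for a quaternion \<open>p\<close>, regarded as a dual quaternion with dual part 0.\<close>

definition tangent_set :: "dquat \<Rightarrow> dquat set" where
  "tangent_set p =
     {p + dq_eps * dq_of_quat \<gamma> | \<gamma>. \<gamma> \<in> imag_quats \<and> qorth \<gamma> (qIm (primal p))}"

definition dq_conjugate :: "dquat \<Rightarrow> dquat \<Rightarrow> dquat" where
  "dq_conjugate h l =
     (if dq_invertible h then inverse h * l * h
      else if h \<in> eps_quats then
        inverse (dq_of_quat (dual h)) * l * dq_of_quat (dual h)
      else l)"


section \<open>Slice functions\<close>

definition circularization :: "complex set \<Rightarrow> dquat set" where
  "circularization D = {of_real \<alpha> + \<beta> *\<^sub>R J | \<alpha> \<beta> J. Complex \<alpha> \<beta> \<in> D \<and> J \<in> dq_units}"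

text \<open>An element \<open>a + \<iota> b\<close> of \<open>\<D>\<H> \<otimes> \<complex>\<close> is represented by the pair \<open>(a, b)\<close>; the
  multiplication of this algebra plays no role below.\<close>

type_synonym dquat_complex = "dquat \<times> dquat"

definition dqc_cnj :: "dquat_complex \<Rightarrow> dquat_complex" where
  "dqc_cnj w = (dq_cnj (fst w), dq_cnj (snd w))"

definition stem_function :: "complex set \<Rightarrow> (complex \<Rightarrow> dquat_complex) \<Rightarrow> bool" where
  "stem_function D F \<longleftrightarrow>
     (\<forall>z\<in>D. fst (F (cnj z)) = fst (F z) \<and> snd (F (cnj z)) = - snd (F z))"

text \<open>The slice function induced by a stem function \<open>F\<close>. It is well defined, see
  \<open>induced_decomp\<close>; outside of its domain it is \<^const>\<open>undefined\<close>, so that slice functions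
  are determined by their values on the domain.\<close>

definition induced :: "complex set \<Rightarrow> (complex \<Rightarrow> dquat_complex) \<Rightarrow> dquat \<Rightarrow> dquat" where
  "induced D F = (\<lambda>x. if x \<in> circularization D then
     (THE v. \<exists>\<alpha> \<beta> J. Complex \<alpha> \<beta> \<in> D \<and> J \<in> dq_units \<and> x = of_real \<alpha> + \<beta> *\<^sub>R J \<and>
        v = fst (F (Complex \<alpha> \<beta>)) + J * snd (F (Complex \<alpha> \<beta>)))
     else undefined)"

definition slice_functions :: "complex set \<Rightarrow> (dquat \<Rightarrow> dquat) set" where
  "slice_functions D = {induced D F | F. stem_function D F}"

text \<open>The stem function inducing a slice function is uniquely determined on \<open>D\<close>, so the choice
  below is harmless (\<open>slice_conj_induced\<close>).\<close>

definition slice_conj :: "complex set \<Rightarrow> (dquat \<Rightarrow> dquat) \<Rightarrow> dquat \<Rightarrow> dquat" where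
  "slice_conj D f = induced D (\<lambda>z. dqc_cnj ((SOME F. stem_function D F \<and> f = induced D F) z))"

definition spherical_value :: "(dquat \<Rightarrow> dquat) \<Rightarrow> dquat \<Rightarrow> dquat" where
  "spherical_value f x = (1 / 2) *\<^sub>R (f x + f (dq_cnj x))"

definition spherical_deriv :: "(dquat \<Rightarrow> dquat) \<Rightarrow> dquat \<Rightarrow> dquat" where
  "spherical_deriv f x = (1 / 2) *\<^sub>R (inverse (dq_Im x) * (f x - f (dq_cnj x)))"

definition zero_set :: "complex set \<Rightarrow> (dquat \<Rightarrow> dquat) \<Rightarrow> dquat set" where
  "zero_set D f = {x \<in> circularization D. f x = 0}"

lemma induced_decomp:
  assumes F: "stem_function D F" and D: "Complex \<alpha> \<beta> \<in> D" and J: "J \<in> dq_units"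
  shows "induced D F (of_real \<alpha> + \<beta> *\<^sub>R J) = fst (F (Complex \<alpha> \<beta>)) + J * snd (F (Complex \<alpha> \<beta>))"
proof -
  have "(THE v. \<exists>a b I. Complex a b \<in> D \<and> I \<in> dq_units \<and>
          of_real \<alpha> + \<beta> *\<^sub>R J = of_real a + b *\<^sub>R I \<and>
          v = fst (F (Complex a b)) + I * snd (F (Complex a b)))
      = fst (F (Complex \<alpha> \<beta>)) + J * snd (F (Complex \<alpha> \<beta>))"
  proof (rule the_equality)
    fix v
    assume "\<exists>a b I. Complex a b \<in> D \<and> I \<in> dq_units \<and>
          of_real \<alpha> + \<beta> *\<^sub>R J = of_real a + b *\<^sub>R I \<and>
          v = fst (F (Complex a b)) + I * snd (F (Complex a b))"
    then obtain a b I where *: "I \<in> dq_units" "of_real \<alpha> + \<beta> *\<^sub>R J = of_real a + b *\<^sub>R I"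
      "v = fst (F (Complex a b)) + I * snd (F (Complex a b))"
      by blast
    have a: "a = \<alpha>" and b: "(b = \<beta> \<and> (\<beta> = 0 \<or> I = J)) \<or> (b = - \<beta> \<and> I = - J)"
      using dq_decomp_unique[OF *(2) J *(1)] by auto
    have cnj: "cnj (Complex \<alpha> \<beta>) = Complex \<alpha> (- \<beta>)" by (simp add: complex_eq_iff)
    have sym: "fst (F (Complex \<alpha> (- \<beta>))) = fst (F (Complex \<alpha> \<beta>))"
      "snd (F (Complex \<alpha> (- \<beta>))) = - snd (F (Complex \<alpha> \<beta>))"
      using F D unfolding stem_function_def by (auto simp flip: cnj)
    consider "b = \<beta>" "I = J" | "b = 0" "\<beta> = 0" | "b = - \<beta>" "I = - J" using b by auto
    thus "v = fst (F (Complex \<alpha> \<beta>)) + J * snd (F (Complex \<alpha> \<beta>))"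
    proof cases
      case 2
      have "snd (F (Complex \<alpha> 0)) = - snd (F (Complex \<alpha> 0))" using sym(2) 2 by simp
      hence "(2::real) *\<^sub>R snd (F (Complex \<alpha> 0)) = 0" by (metis add.right_inverse scaleR_2)
      hence "snd (F (Complex \<alpha> 0)) = 0" by simp
      thus ?thesis using *(3) a 2 by simp
    qed (use * a sym in auto)
  qed (use D J in blast)
  moreover have "of_real \<alpha> + \<beta> *\<^sub>R J \<in> circularization D"
    using D J unfolding circularization_def by blast
  ultimately show ?thesis by (simp add: induced_def)
qed

lemma induced_cong: "(\<And>z. z \<in> D \<Longrightarrow> F z = G z) \<Longrightarrow> induced D F = induced D G"
  unfolding induced_def by (intro ext if_cong refl arg_cong[where f = The]) metis

lemma stem_unique:
  assumes D: "cnj ` D \<subseteq> D" and F: "stem_function D F" and G: "stem_function D G"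
    and eq: "induced D F = induced D G" and z: "z \<in> D"
  shows "F z = G z"
proof -
  obtain J where J: "J \<in> dq_units" using dq_units_ne by blast
  obtain a b where zab: "z = Complex a b" by (cases z)
  define u where "u = fst (F z) - fst (G z)"
  define v where "v = J * snd (F z) - J * snd (G z)"
  have "fst (F z) + J * snd (F z) = fst (G z) + J * snd (G z)"
    using induced_decomp[OF F _ J] induced_decomp[OF G _ J] eq z zab by metis
  hence 1: "u + v = 0" by (simp add: u_def v_def algebra_simps)
  have "fst (F z) + (- J) * snd (F z) = fst (G z) + (- J) * snd (G z)"
    using induced_decomp[OF F _ dq_units_uminus[OF J]] induced_decomp[OF G _ dq_units_uminus[OF J]]
      eq z zab by metis
  hence 2: "u - v = 0" by (simp add: u_def v_def algebra_simps)
  have "(2::real) *\<^sub>R u = (u + v) + (u - v)" by (simp add: scaleR_2)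
  hence u: "u = 0" using 1 2 by simp
  hence "v = 0" using 1 by simp
  thus ?thesis using u dq_units_cancel[OF J] by (simp add: u_def v_def prod_eq_iff)
qed

lemma slice_conj_induced:
  assumes "cnj ` D \<subseteq> D" "stem_function D F"
  shows "slice_conj D (induced D F) = induced D (\<lambda>z. dqc_cnj (F z))"
proof -
  define G where "G = (SOME G. stem_function D G \<and> induced D F = induced D G)"
  have "stem_function D G \<and> induced D F = induced D G"
    unfolding G_def by (rule someI[of _ F]) (use assms in auto)
  hence "\<And>z. z \<in> D \<Longrightarrow> G z = F z" using stem_unique[OF assms(1)] assms(2) by metis
  thus ?thesis unfolding slice_conj_def G_def[symmetric] by (intro induced_cong) auto
qed

end

theory Submission
  imports Defs
begin

text \<open>Let \<open>x = \<alpha> + \<beta> J\<close> with \<open>\<beta> \<noteq> 0\<close>, and let \<open>v\<close>, \<open>d\<close> be the spherical value and derivative of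
  \<open>f\<close> at \<open>x\<close>. On \<open>\<S>\<^sub>x\<close> one has \<open>f (\<alpha> + \<beta> I) = v + \<beta> I d\<close>, whose zeros are found by
  distinguishing \<open>d\<close> invertible, \<open>d \<in> \<epsilon>\<H>\<^sup>*\<close> and \<open>d = 0\<close>. Conjugating,
  \<open>\<alpha> + \<beta> I\<close> is a zero of \<open>f\<^sup>c\<close> iff \<open>v = \<beta> d I\<close>. In all three cases \<open>l \<mapsto> \<C>(d, l)\<close> is an inner
  automorphism satisfying \<open>d \<C>(d, l) = l d\<close>; hence \<open>y \<mapsto> \<C>(d, y\<^sup>c)\<close> maps the zeros of \<open>f\<close> on
  \<open>\<S>\<^sub>x\<close> onto those of \<open>f\<^sup>c\<close>.\<close>

section \<open>Conjugation, imaginary units and inverses\<close>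

lemma dq_cnj_mult: "dq_cnj (h * l) = dq_cnj l * dq_cnj h"
  by (simp add: dquat_eq_iff quat_eq_iff algebra_simps)

lemma dq_cnj_diff: "dq_cnj (h - l) = dq_cnj h - dq_cnj l"
  by (simp add: dquat_eq_iff quat_eq_iff)

lemma dq_cnj_scaleR: "dq_cnj (r *\<^sub>R h) = r *\<^sub>R dq_cnj h"
  by (simp add: dquat_eq_iff quat_eq_iff)

lemma dq_cnj_eq_0_iff: "dq_cnj h = 0 \<longleftrightarrow> h = 0"
  by (simp add: dquat_eq_iff quat_eq_iff)

text \<open>The equation \<open>J * J = -1\<close> involves only the product, so it passes through
  inner automorphisms and through the projection to primal parts; units are recognised by it
  below.\<close>

lemma dq_units_iff_square: "J \<in> dq_units \<longleftrightarrow> J * J = -1"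
proof
  assume J: "J * J = -1"
  define r x y z s u v w where vars: "r = qRe (primal J)" "x = qI (primal J)" "y = qJ (primal J)"
    "z = qK (primal J)" "s = qRe (dual J)" "u = qI (dual J)" "v = qJ (dual J)" "w = qK (dual J)"
  have p: "r * r - x * x - y * y - z * z = -1" "r * x = 0" "r * y = 0" "r * z = 0"
    and d: "r * s = x * u + y * v + z * w" "r * u + s * x = 0" "r * v + s * y = 0" "r * w + s * z = 0"
    using J unfolding dquat_eq_iff quat_eq_iff vars by (simp_all add: algebra_simps)
  have r: "r = 0"
  proof (rule ccontr)
    \<comment> \<open>The vector part \<open>(x, y, z)\<close> would vanish, leaving a real number
      with square -1.\<close>
    assume "r \<noteq> 0"
    hence "r * r = -1" using p by simp
    thus False by (smt (verit) zero_le_square)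
  qed
  \<comment> \<open>With \<open>r = 0\<close> the vector \<open>(x, y, z)\<close> has length 1, so
    some coordinate is nonzero, while its products with \<open>s\<close> all vanish.\<close>
  moreover have "s = 0"
    using p d r by auto
  ultimately show "J \<in> dq_units"
    using p d unfolding dq_units_def dq_trace_def dq_norm_def dquat_eq_iff quat_eq_iff
    by (simp add: vars algebra_simps)
qed (rule dq_units_square)

lemma dq_inverse:
  assumes "primal h \<noteq> 0"
  shows "h * inverse h = 1" "inverse h * h = 1"
  using assms dq_inverse_unique unfolding dq_invertible_iff[symmetric] dq_invertible_def by metis+

lemma dq_of_quat_simps [simp]: "primal (dq_of_quat q) = q" "dual (dq_of_quat q) = 0"
  by (simp_all add: dq_of_quat_def)

lemma dq_eps_simps [simp]: "primal dq_eps = 0" "dual dq_eps = 1"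
  by (simp_all add: dq_eps_def)

lemma inverse_dq_of_quat: "q \<noteq> 0 \<Longrightarrow> inverse (dq_of_quat q) = dq_of_quat (inverse q)"
  by (rule dq_inverse_unique) (simp_all add: dquat_eq_iff)

lemma range_dq_of_quat: "h \<in> range dq_of_quat \<longleftrightarrow> dual h = 0"
  by (metis dq_of_quat_simps dquat_eq_iff imageE rangeI)

lemma eps_quats_iff: "h \<in> eps_quats \<longleftrightarrow> primal h = 0 \<and> dual h \<noteq> 0"
proof
  assume "primal h = 0 \<and> dual h \<noteq> 0"
  hence "h = dq_eps * dq_of_quat (dual h)" "dual h \<noteq> 0" by (simp_all add: dquat_eq_iff)
  thus "h \<in> eps_quats" unfolding eps_quats_def by blast
qed (auto simp: eps_quats_def)

section \<open>The maps \<open>dq_conjugate h\<close> as inner automorphisms\<close>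

text \<open>The conjugating element \<open>c\<close> is \<open>h\<close>, the quaternion
  \<open>dual h\<close> or 1, according to the three branches of the definition. Producing one
  \<open>c\<close> for all \<open>l\<close> spares the later lemmas this case distinction.\<close>

lemma dq_conjugate_inner:
  obtains c where "primal c \<noteq> 0" "\<And>l. dq_conjugate h l = inverse c * l * c"
    "\<And>l. h * dq_conjugate h l = l * h"
proof -
  consider "primal h \<noteq> 0" | "h \<in> eps_quats" | "h = 0"
    by (auto simp: eps_quats_iff dquat_eq_iff)
  thus thesis
  proof cases
    case 1
    thus thesis
      by (intro that[of h])
         (simp_all add: dq_conjugate_def dq_invertible_iff dq_inverse flip: mult.assoc)
  next
    case 2
    let ?c = "dq_of_quat (dual h)"
    have h: "primal h = 0" "dual h \<noteq> 0" using 2 by (simp_all add: eps_quats_iff)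
    have conj: "dq_conjugate h l = inverse ?c * l * ?c" for l
      using 2 h by (simp add: dq_conjugate_def dq_invertible_iff)
    show thesis
    proof (rule that[of ?c])
      \<comment> \<open>Since \<open>primal h = 0\<close>, both products are purely dual and see
        only \<open>primal l\<close>; each has dual part \<open>primal l * dual h\<close>.\<close>
      show "h * dq_conjugate h l = l * h" for l
        using h unfolding conj
        by (simp add: dquat_eq_iff inverse_dq_of_quat flip: mult.assoc)
    qed (use h conj in auto)
  next
    case 3
    show thesis
      by (rule that[of 1])
         (use 3 dq_inverse[of 1] in \<open>simp_all add: dq_conjugate_def dq_invertible_iff eps_quats_iff\<close>)
  qed
qed

lemma dq_conjugate_commute: "h * dq_conjugate h l = l * h"
  by (rule dq_conjugate_inner[of h]) auto

text \<open>Real numbers are central, hence fixed; on a sphere the map therefore acts through the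
  imaginary unit alone.\<close>

lemma dq_conjugate_affine:
  "dq_conjugate h (of_real a + b *\<^sub>R l) = of_real a + b *\<^sub>R dq_conjugate h l"
proof -
  obtain c where c: "primal c \<noteq> 0" "\<And>l. dq_conjugate h l = inverse c * l * c"
    by (rule dq_conjugate_inner[of h]) blast
  show ?thesis
    by (simp add: c(2) algebra_simps of_real_def dq_inverse[OF c(1)])
qed

text \<open>Automorphisms preserve the solutions of \<open>J * J = -1\<close>; the inverse
  automorphism, with \<open>c\<close> and \<open>inverse c\<close> exchanged, provides the
  preimages.\<close>

lemma dq_conjugate_units: "dq_conjugate h ` dq_units = dq_units"
proof -
  obtain c where c: "primal c \<noteq> 0" "\<And>l. dq_conjugate h l = inverse c * l * c"
    by (rule dq_conjugate_inner[of h]) blast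
  note inv = dq_inverse[OF c(1)]
  have cancel: "c * (inverse c * l) = l" "inverse c * (c * l) = l" for l
    by (simp_all add: inv flip: mult.assoc)
  show ?thesis
  proof (intro equalityI subsetI)
    fix J assume "J \<in> dq_conjugate h ` dq_units"
    then obtain I where I: "J = inverse c * I * c" "I * I = -1"
      by (auto simp: c(2) dq_units_iff_square)
    have "J * J = inverse c * (I * I) * c" by (simp add: I(1) mult.assoc cancel)
    thus "J \<in> dq_units" by (simp add: I(2) inv dq_units_iff_square)
  next
    fix J assume "J \<in> dq_units"
    hence J: "J * J = -1" by (simp add: dq_units_iff_square)
    have "(c * J * inverse c) * (c * J * inverse c) = c * (J * J) * inverse c"
      by (simp add: mult.assoc cancel)
    hence "c * J * inverse c \<in> dq_units" by (simp add: J inv dq_units_iff_square)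
    moreover have "J = dq_conjugate h (c * J * inverse c)"
      by (simp add: c(2) mult.assoc cancel inv)
    ultimately show "J \<in> dq_conjugate h ` dq_units" by (rule rev_image_eqI)
  qed
qed

lemma primal_dq_conjugate_cong:
  assumes "primal k = primal l"
  shows "primal (dq_conjugate h k) = primal (dq_conjugate h l)"
  by (rule dq_conjugate_inner[of h]) (simp add: assms)

text \<open>Both \<open>primal c\<close> and \<open>primal (inverse c)\<close> are nonzero
  quaternions and cancel. With the preceding lemma, conjugation maps fibres of \<open>primal\<close>
  to fibres of \<open>primal\<close>.\<close>

lemma primal_dq_conjugate_cancel:
  assumes "primal (dq_conjugate h k) = primal (dq_conjugate h l)"
  shows "primal k = primal l"
proof -
  obtain c where c: "primal c \<noteq> 0" "\<And>l. dq_conjugate h l = inverse c * l * c"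
    by (rule dq_conjugate_inner[of h]) blast
  have "primal (inverse c) \<noteq> 0" using dq_inverse(1)[OF c(1)] by (auto simp: dquat_eq_iff)
  thus ?thesis using assms c by simp
qed

text \<open>Here the conjugating element is itself a quaternion. For an invertible \<open>h\<close>
  with a dual part, conjugation can take a quaternion out of \<H>.\<close>

lemma dq_conjugate_range_dq_of_quat:
  assumes "h \<in> eps_quats" "l \<in> range dq_of_quat"
  shows "dq_conjugate h l \<in> range dq_of_quat"
  using assms unfolding range_dq_of_quat
  by (auto simp: dq_conjugate_def eps_quats_iff dq_invertible_iff inverse_dq_of_quat)

section \<open>Spheres and the tangent sets as fibres of the primal part\<close>

text \<open>This is the sphere of a point with a chosen decomposition; indexing by the coefficients
  avoids the ambiguity of sign in \<open>\<beta>\<close>. It agrees with \<open>dq_sphere\<close> by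
  \<open>dq_sphere_decomp\<close>.\<close>

definition dq_sphere_at :: "real \<Rightarrow> real \<Rightarrow> dquat set" where
  "dq_sphere_at \<alpha> \<beta> = {of_real \<alpha> + \<beta> *\<^sub>R I | I. I \<in> dq_units}"

lemma sphere_dq_conjugate: "dq_conjugate h ` dq_sphere_at \<alpha> \<beta> = dq_sphere_at \<alpha> \<beta>"
proof -
  have sphere: "dq_sphere_at \<alpha> \<beta> = (\<lambda>I. of_real \<alpha> + \<beta> *\<^sub>R I) ` dq_units" by (auto simp: dq_sphere_at_def)
  have "dq_conjugate h ` dq_sphere_at \<alpha> \<beta> = (\<lambda>I. of_real \<alpha> + \<beta> *\<^sub>R I) ` dq_conjugate h ` dq_units"
    by (simp only: sphere image_image dq_conjugate_affine)
  thus ?thesis by (simp only: dq_conjugate_units sphere)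
qed

lemma dq_cnj_dq_cnj [simp]: "dq_cnj (dq_cnj h) = h"
  by (simp add: dquat_eq_iff quat_eq_iff)

lemma sphere_dq_cnj:
  assumes "y \<in> dq_sphere_at \<alpha> \<beta>"
  shows "dq_cnj y \<in> dq_sphere_at \<alpha> \<beta>"
proof -
  obtain I where I: "I \<in> dq_units" "y = of_real \<alpha> + \<beta> *\<^sub>R I"
    using assms by (auto simp: dq_sphere_at_def)
  have "dq_cnj y = of_real \<alpha> + \<beta> *\<^sub>R (- I)" by (simp add: I dq_cnj_decomp)
  thus ?thesis using dq_units_uminus[OF I(1)] unfolding dq_sphere_at_def by blast
qed

text \<open>Perturbing a quaternionic unit \<open>I\<close> by \<epsilon>\<delta> gives a unit
  exactly when \<delta> is imaginary and orthogonal to \<open>I\<close>, which is the condition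
  defining \<open>tangent_set\<close>. As a fibre of \<open>primal\<close>, the set is easy to
  compare with zero sets.\<close>

lemma tangent_set_eq:
  assumes "p \<in> dq_sphere_at \<alpha> \<beta>" "dual p = 0" "\<beta> \<noteq> 0"
  shows "tangent_set p = {y \<in> dq_sphere_at \<alpha> \<beta>. primal y = primal p}"
proof -
  obtain I where I: "I \<in> dq_units" "p = of_real \<alpha> + \<beta> *\<^sub>R I"
    using assms(1) by (auto simp: dq_sphere_at_def)
  have I2: "dual I = 0" using assms(2,3) I(2) by simp
  \<comment> \<open>Moving \<open>p\<close> by \<epsilon>\<gamma> moves its unit by
    \<epsilon>\<gamma>/\<beta>.\<close>
  have key: "\<gamma> \<in> imag_quats \<and> qorth \<gamma> (qIm (primal p)) \<longleftrightarrow> I + dq_eps * dq_of_quat (\<gamma> /\<^sub>R \<beta>) \<in> dq_units"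
    for \<gamma>
  proof -
    have r: "qRe (primal I) = 0" by (rule dq_units_qRe[OF I(1)])
    have n: "primal I * qcnj (primal I) = 1" "primal I + qcnj (primal I) = 0"
      using I(1) by (simp_all add: dq_units_def dq_trace_def dq_norm_def dquat_eq_iff)
    have "I + dq_eps * dq_of_quat (\<gamma> /\<^sub>R \<beta>) \<in> dq_units \<longleftrightarrow>
        \<gamma> /\<^sub>R \<beta> + qcnj (\<gamma> /\<^sub>R \<beta>) = 0 \<and>
        primal I * qcnj (\<gamma> /\<^sub>R \<beta>) + (\<gamma> /\<^sub>R \<beta>) * qcnj (primal I) = 0"
      using n I2 by (simp add: dq_units_def dq_trace_def dq_norm_def dquat_eq_iff)
    \<comment> \<open>The sum \<open>p * qcnj q + q * qcnj p\<close> is real, namely twice the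
      Euclidean scalar product, so both orthogonality conditions become one coordinate
      equation.\<close>
    also have "\<dots> \<longleftrightarrow> qRe \<gamma> = 0 \<and> qI (primal I) * qI \<gamma> + qJ (primal I) * qJ \<gamma> + qK (primal I) * qK \<gamma> = 0"
    proof -
      have "primal I * qcnj (\<gamma> /\<^sub>R \<beta>) + (\<gamma> /\<^sub>R \<beta>) * qcnj (primal I) = 0 \<longleftrightarrow>
          (2 * inverse \<beta>) * (qI (primal I) * qI \<gamma> + qJ (primal I) * qJ \<gamma> + qK (primal I) * qK \<gamma>) = 0"
        if "qRe \<gamma> = 0"
        using r that by (simp add: quat_eq_iff algebra_simps del: mult_eq_0_iff)
      moreover have "\<gamma> /\<^sub>R \<beta> + qcnj (\<gamma> /\<^sub>R \<beta>) = 0 \<longleftrightarrow> qRe \<gamma> = 0"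
        using assms(3) by (simp add: quat_eq_iff)
      ultimately show ?thesis using assms(3) by auto
    qed
    also have "\<dots> \<longleftrightarrow> \<gamma> \<in> imag_quats \<and> qorth \<gamma> (qIm (primal p))"
    proof -
      have "qorth \<gamma> (qIm (primal p)) \<longleftrightarrow>
          (2 * \<beta>) * (qI (primal I) * qI \<gamma> + qJ (primal I) * qJ \<gamma> + qK (primal I) * qK \<gamma>) = 0"
        by (simp add: qorth_def qIm_def I(2) quat_eq_iff algebra_simps)
      thus ?thesis using assms(3) by (simp add: imag_quats_def)
    qed
    finally show ?thesis by simp
  qed
  show ?thesis
  proof (intro equalityI subsetI)
    fix y assume "y \<in> tangent_set p"
    then obtain \<gamma> where \<gamma>: "y = p + dq_eps * dq_of_quat \<gamma>" "I + dq_eps * dq_of_quat (\<gamma> /\<^sub>R \<beta>) \<in> dq_units"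
      unfolding tangent_set_def key by blast
    have "y = of_real \<alpha> + \<beta> *\<^sub>R (I + dq_eps * dq_of_quat (\<gamma> /\<^sub>R \<beta>))"
      using assms(3) by (simp add: \<gamma>(1) I(2) dquat_eq_iff scaleR_right_distrib)
    hence "y \<in> dq_sphere_at \<alpha> \<beta>" using \<gamma>(2) unfolding dq_sphere_at_def by blast
    thus "y \<in> {y \<in> dq_sphere_at \<alpha> \<beta>. primal y = primal p}" by (simp add: \<gamma>(1))
  next
    fix y assume "y \<in> {y \<in> dq_sphere_at \<alpha> \<beta>. primal y = primal p}"
    then obtain J where J: "J \<in> dq_units" "y = of_real \<alpha> + \<beta> *\<^sub>R J" "primal y = primal p"
      unfolding dq_sphere_at_def by blast
    have "primal J = primal I" using J(2,3) I(2) assms(3) by simp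
    \<comment> \<open>The points \<open>y\<close> and \<open>p\<close> differ only in the dual part,
      so the tangent vector must be \<open>\<beta> *\<^sub>R dual J\<close>.\<close>
    hence "I + dq_eps * dq_of_quat ((\<beta> *\<^sub>R dual J) /\<^sub>R \<beta>) = J"
      using assms(3) I2 by (simp add: dquat_eq_iff)
    moreover have "y = p + dq_eps * dq_of_quat (\<beta> *\<^sub>R dual J)"
      using J(2,3) assms(2) by (simp add: dquat_eq_iff)
    ultimately show "y \<in> tangent_set p"
      unfolding tangent_set_def key using J(1) by auto
  qed
qed

text \<open>The primal part is a ring homomorphism, so \<open>I * I = -1\<close> survives. This
  supplies the base point of the tangent set in the third case.\<close>

lemma sphere_of_primal:
  assumes "y \<in> dq_sphere_at \<alpha> \<beta>"
  shows "dq_of_quat (primal y) \<in> dq_sphere_at \<alpha> \<beta>"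
proof -
  obtain I where I: "I * I = -1" "y = of_real \<alpha> + \<beta> *\<^sub>R I"
    using assms by (auto simp: dq_sphere_at_def dq_units_iff_square)
  have "dq_of_quat (primal I) \<in> dq_units"
    using I(1) by (simp add: dq_units_iff_square dquat_eq_iff)
  moreover have "dq_of_quat (primal y) = of_real \<alpha> + \<beta> *\<^sub>R dq_of_quat (primal I)"
    by (simp add: I(2) dquat_eq_iff)
  ultimately show ?thesis unfolding dq_sphere_at_def by blast
qed

section \<open>Zeros of v + (y - \<alpha>) d on a sphere and of its conjugate\<close>

text \<open>Put \<open>K = dq_conjugate d I\<close>. Since \<open>K\<close> is a unit and
  \<open>d * K = I * d\<close>, the conjugate function at \<alpha> + \<beta>K is the conjugate of v
  - \<beta>Id, the value of the original one at \<alpha> - \<beta>I.\<close>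

lemma slice_conj_zeros:
  "{y \<in> dq_sphere_at \<alpha> \<beta>. dq_cnj v + (y - of_real \<alpha>) * dq_cnj d = 0} =
   (\<lambda>y. dq_conjugate d (dq_cnj y)) ` {y \<in> dq_sphere_at \<alpha> \<beta>. v + (y - of_real \<alpha>) * d = 0}"
proof -
  have conj: "dq_cnj v + (\<beta> *\<^sub>R dq_conjugate d I) * dq_cnj d = 0 \<longleftrightarrow> v - (\<beta> *\<^sub>R I) * d = 0"
    if "I \<in> dq_units" for I
  proof -
    have J: "dq_conjugate d I \<in> dq_units" using that dq_conjugate_units by blast
    have "dq_cnj v + (\<beta> *\<^sub>R dq_conjugate d I) * dq_cnj d = dq_cnj (v - \<beta> *\<^sub>R (d * dq_conjugate d I))"
      by (simp add: dq_cnj_diff dq_cnj_scaleR dq_cnj_mult dq_units_cnj[OF J])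
    thus ?thesis by (simp add: dq_cnj_eq_0_iff dq_conjugate_commute)
  qed
  show ?thesis
  proof (intro equalityI subsetI)
    fix y assume y: "y \<in> {y \<in> dq_sphere_at \<alpha> \<beta>. dq_cnj v + (y - of_real \<alpha>) * dq_cnj d = 0}"
    then obtain K where K: "K \<in> dq_units" "y = of_real \<alpha> + \<beta> *\<^sub>R K" by (auto simp: dq_sphere_at_def)
    \<comment> \<open>Surjectivity on units lets every zero be written through some
      \<open>I\<close>; its partner carries \<open>- I\<close>, the sign which \<open>dq_cnj\<close>
      undoes.\<close>
    then obtain I where I: "I \<in> dq_units" "K = dq_conjugate d I" using dq_conjugate_units by blast
    have "v - (\<beta> *\<^sub>R I) * d = 0" using y conj[OF I(1)] by (simp add: K(2) I(2))
    moreover have "of_real \<alpha> + \<beta> *\<^sub>R (- I) \<in> dq_sphere_at \<alpha> \<beta>"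
      using dq_units_uminus[OF I(1)] unfolding dq_sphere_at_def by blast
    ultimately have "of_real \<alpha> + \<beta> *\<^sub>R (- I) \<in> {y \<in> dq_sphere_at \<alpha> \<beta>. v + (y - of_real \<alpha>) * d = 0}"
      by simp
    moreover have "y = dq_conjugate d (dq_cnj (of_real \<alpha> + \<beta> *\<^sub>R (- I)))"
      unfolding dq_cnj_decomp[OF dq_units_uminus[OF I(1)]]
      by (simp add: K(2) I(2) dq_conjugate_affine)
    ultimately show "y \<in> (\<lambda>y. dq_conjugate d (dq_cnj y)) ` {y \<in> dq_sphere_at \<alpha> \<beta>. v + (y - of_real \<alpha>) * d = 0}"
      by (rule rev_image_eqI)
  next
    fix y assume "y \<in> (\<lambda>y. dq_conjugate d (dq_cnj y)) ` {y \<in> dq_sphere_at \<alpha> \<beta>. v + (y - of_real \<alpha>) * d = 0}"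
    then obtain I where I: "I \<in> dq_units" "v + (\<beta> *\<^sub>R I) * d = 0"
        "y = dq_conjugate d (dq_cnj (of_real \<alpha> + \<beta> *\<^sub>R I))"
      by (auto simp: dq_sphere_at_def)
    have y: "y = of_real \<alpha> + \<beta> *\<^sub>R dq_conjugate d (- I)"
      using I(3) dq_conjugate_affine[of d \<alpha> \<beta> "- I"] by (simp add: dq_cnj_decomp[OF I(1)])
    have "- I \<in> dq_units" by (rule dq_units_uminus[OF I(1)])
    moreover from this have "dq_conjugate d (- I) \<in> dq_units" using dq_conjugate_units by blast
    ultimately show "y \<in> {y \<in> dq_sphere_at \<alpha> \<beta>. dq_cnj v + (y - of_real \<alpha>) * dq_cnj d = 0}"
      using conj[of "- I"] I(2) unfolding y dq_sphere_at_def by auto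
  qed
qed

text \<open>Given one zero \<open>y\<close>, a point \<open>u\<close> of the sphere is another iff
  \<open>(u - y) * d = 0\<close>. This leaves one point, a fibre of \<open>primal\<close> or the
  whole sphere, depending on how degenerate \<open>d\<close> is.\<close>

lemma sphere_zeros_cases:
  fixes v d :: dquat and \<alpha> \<beta> :: real
  assumes "\<beta> \<noteq> 0"
  defines "Z \<equiv> {y \<in> dq_sphere_at \<alpha> \<beta>. v + (y - of_real \<alpha>) * d = 0}"
  shows "Z = {} \<or>
    (\<exists>y. Z = {y} \<and> dq_invertible d \<and> y = of_real \<alpha> - v * inverse d) \<or>
    (\<exists>p. p \<in> dq_sphere_at \<alpha> \<beta> \<inter> range dq_of_quat \<and> Z = tangent_set p \<and> d \<in> eps_quats \<and> v \<in> eps_quats) \<or>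
    (dq_sphere_at \<alpha> \<beta> \<subseteq> Z \<and> d = 0 \<and> v = 0)"
proof (cases "Z = {}")
  case False
  then obtain y where y: "y \<in> dq_sphere_at \<alpha> \<beta>" "v + (y - of_real \<alpha>) * d = 0" by (auto simp: Z_def)
  consider "primal d \<noteq> 0" | "d \<in> eps_quats" | "d = 0"
    by (auto simp: eps_quats_iff dquat_eq_iff)
  thus ?thesis
  proof cases
    case 1
    have "u = of_real \<alpha> - v * inverse d" if "v + (u - of_real \<alpha>) * d = 0" for u
    proof -
      have "v = - ((u - of_real \<alpha>) * d)" using that by (simp add: eq_neg_iff_add_eq_0)
      hence "v * inverse d = - (u - of_real \<alpha>)" by (simp add: mult.assoc dq_inverse[OF 1])
      thus ?thesis by simp
    qed
    hence "Z = {y}" "y = of_real \<alpha> - v * inverse d" using y by (auto simp: Z_def)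
    thus ?thesis using 1 by (auto simp: dq_invertible_iff)
  next
    case 2
    hence d: "primal d = 0" "dual d \<noteq> 0" by (simp_all add: eps_quats_iff)
    let ?p = "dq_of_quat (primal y)"
    have p: "?p \<in> dq_sphere_at \<alpha> \<beta>" by (rule sphere_of_primal[OF y(1)])
    have "v + (u - of_real \<alpha>) * d = 0 \<longleftrightarrow> primal u = primal y" for u
    proof -
      \<comment> \<open>As \<open>primal d = 0\<close>, the only component left is
        \<open>primal (u - y) * dual d\<close>, and \<H> has no zero divisors.\<close>
      have "v + (u - of_real \<alpha>) * d = (u - y) * d" using y(2) by (simp add: algebra_simps eq_neg_iff_add_eq_0)
      thus ?thesis using d by (simp add: dquat_eq_iff)
    qed
    hence "Z = tangent_set ?p" using tangent_set_eq[OF p _ assms(1)] by (simp add: Z_def)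
    moreover have "v \<in> eps_quats"
    proof -
      obtain I where I: "I * I = -1" "y = of_real \<alpha> + \<beta> *\<^sub>R I"
        using y(1) by (auto simp: dq_sphere_at_def dq_units_iff_square)
      \<comment> \<open>Then v = -\<beta>Id inherits from \<open>d\<close> a zero primal part and a
        nonzero dual part.\<close>
      have "primal I \<noteq> 0" using I(1) by (auto simp: dquat_eq_iff)
      moreover have "v = - (\<beta> *\<^sub>R (I * d))" using y(2) I(2) by (simp add: eq_neg_iff_add_eq_0)
      ultimately show ?thesis using d assms(1) by (simp add: eps_quats_iff)
    qed
    ultimately show ?thesis using 2 p by blast
  next
    case 3
    thus ?thesis using y(2) by (auto simp: Z_def)
  qed
qed simp

text \<open>Both sides are fibres of \<open>primal\<close> on the same sphere, and conjugation
  respects these fibres. Membership of \<open>h\<close> in \<open>eps_quats\<close> keeps the new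
  base point in \<H>, so that \<open>tangent_set_eq\<close> applies to it.\<close>

lemma tangent_set_dq_conjugate:
  assumes "p \<in> dq_sphere_at \<alpha> \<beta>" "p \<in> range dq_of_quat" "h \<in> eps_quats" "\<beta> \<noteq> 0"
  shows "(\<lambda>y. dq_conjugate h (dq_cnj y)) ` tangent_set p = tangent_set (dq_conjugate h (dq_cnj p))"
proof -
  have p2: "dual p = 0" using assms(2) by (simp add: range_dq_of_quat)
  have c: "dq_cnj p \<in> range dq_of_quat" using p2 by (simp add: range_dq_of_quat quat_eq_iff)
  have q2: "dual (dq_conjugate h (dq_cnj p)) = 0"
    using dq_conjugate_range_dq_of_quat[OF assms(3) c] by (simp add: range_dq_of_quat)
  have mem: "dq_conjugate h (dq_cnj u) \<in> dq_sphere_at \<alpha> \<beta>" if "u \<in> dq_sphere_at \<alpha> \<beta>" for u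
    using sphere_dq_cnj[OF that] sphere_dq_conjugate by blast
  show ?thesis
    unfolding tangent_set_eq[OF assms(1) p2 assms(4)] tangent_set_eq[OF mem[OF assms(1)] q2 assms(4)]
  proof (intro equalityI subsetI)
    fix y assume y: "y \<in> {y \<in> dq_sphere_at \<alpha> \<beta>. primal y = primal (dq_conjugate h (dq_cnj p))}"
    then obtain u where u: "u \<in> dq_sphere_at \<alpha> \<beta>" "y = dq_conjugate h u"
      using sphere_dq_conjugate by blast
    have "primal u = primal (dq_cnj p)"
      by (rule primal_dq_conjugate_cancel[of h]) (use y u in auto)
    hence "primal (dq_cnj u) = primal p" by (simp add: quat_eq_iff)
    with u show "y \<in> (\<lambda>y. dq_conjugate h (dq_cnj y)) ` {y \<in> dq_sphere_at \<alpha> \<beta>. primal y = primal p}"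
      by (intro image_eqI[of _ _ "dq_cnj u"]) (auto intro: sphere_dq_cnj)
  qed (auto intro: mem primal_dq_conjugate_cong)
qed

section \<open>Slice functions on a single sphere\<close>

lemma stem_function_dqc_cnj: "stem_function D F \<Longrightarrow> stem_function D (\<lambda>z. dqc_cnj (F z))"
  by (auto simp: stem_function_def dqc_cnj_def dquat_eq_iff quat_eq_iff)

lemma stem_function_real:
  assumes "stem_function D F" "Complex a 0 \<in> D"
  shows "snd (F (Complex a 0)) = 0"
proof -
  have "cnj (Complex a 0) = Complex a 0" by (simp add: complex_eq_iff)
  hence "snd (F (Complex a 0)) = - snd (F (Complex a 0))"
    using assms unfolding stem_function_def by metis
  thus ?thesis by (simp add: dquat_eq_iff quat_eq_iff)
qed

text \<open>For y = \<alpha> + \<beta>I, the term \<open>I * snd (F z)\<close> is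
  \<open>y - of_real \<alpha>\<close> times \<open>snd (F z)\<close> divided by \<beta>, so the
  slice function is affine in \<open>y\<close> on the sphere.\<close>

lemma zero_set_sphere:
  assumes "stem_function D F" "Complex \<alpha> \<beta> \<in> D" "\<beta> \<noteq> 0"
  shows "zero_set D (induced D F) \<inter> dq_sphere_at \<alpha> \<beta> =
    {y \<in> dq_sphere_at \<alpha> \<beta>. fst (F (Complex \<alpha> \<beta>)) + (y - of_real \<alpha>) * (snd (F (Complex \<alpha> \<beta>)) /\<^sub>R \<beta>) = 0}"
proof -
  have "dq_sphere_at \<alpha> \<beta> \<subseteq> circularization D"
    using assms(2) unfolding dq_sphere_at_def circularization_def by blast
  moreover have "induced D F y =
      fst (F (Complex \<alpha> \<beta>)) + (y - of_real \<alpha>) * (snd (F (Complex \<alpha> \<beta>)) /\<^sub>R \<beta>)"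
    if "y \<in> dq_sphere_at \<alpha> \<beta>" for y
    using that assms by (auto simp: dq_sphere_at_def induced_decomp)
  ultimately show ?thesis by (auto simp: zero_set_def)
qed

lemma spherical_decomp:
  assumes "stem_function D F" "Complex \<alpha> \<beta> \<in> D" "\<beta> \<noteq> 0" "J \<in> dq_units"
  shows "spherical_value (induced D F) (of_real \<alpha> + \<beta> *\<^sub>R J) = fst (F (Complex \<alpha> \<beta>))"
    and "spherical_deriv (induced D F) (of_real \<alpha> + \<beta> *\<^sub>R J) = snd (F (Complex \<alpha> \<beta>)) /\<^sub>R \<beta>"
proof -
  let ?A = "fst (F (Complex \<alpha> \<beta>))" and ?B = "snd (F (Complex \<alpha> \<beta>))"
  have 1: "induced D F (of_real \<alpha> + \<beta> *\<^sub>R J) = ?A + J * ?B"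
    by (rule induced_decomp[OF assms(1,2,4)])
  have 2: "induced D F (dq_cnj (of_real \<alpha> + \<beta> *\<^sub>R J)) = ?A - J * ?B"
    using induced_decomp[OF assms(1,2) dq_units_uminus[OF assms(4)]]
    by (simp add: dq_cnj_decomp[OF assms(4)])
  show "spherical_value (induced D F) (of_real \<alpha> + \<beta> *\<^sub>R J) = ?A"
    unfolding spherical_value_def 1 2 by (simp flip: scaleR_2)
  \<comment> \<open>This inverts the imaginary part of the point, using
    \<open>J * J = -1\<close>.\<close>
  have inv: "inverse (\<beta> *\<^sub>R J) = - (J /\<^sub>R \<beta>)"
    by (rule dq_inverse_unique) (use assms(3) in \<open>simp_all add: dq_units_square[OF assms(4)]\<close>)
  have "?A + J * ?B - (?A - J * ?B) = 2 *\<^sub>R (J * ?B)" by (simp add: scaleR_2)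
  thus "spherical_deriv (induced D F) (of_real \<alpha> + \<beta> *\<^sub>R J) = ?B /\<^sub>R \<beta>"
    unfolding spherical_deriv_def 1 2 dq_Im_decomp[OF assms(4)] inv
    by (simp add: dq_units_square[OF assms(4)] flip: mult.assoc)
qed

section \<open>Zeros of a slice function and of its slice conjugate\<close>

theorem theorem5p2:
  fixes D :: "complex set" and f :: "dquat \<Rightarrow> dquat" and x :: dquat
  assumes "cnj ` D \<subseteq> D"
    and "f \<in> slice_functions D"
  shows
    "(x \<in> circularization D \<inter> \<real> \<longrightarrow>
        (let S = dq_sphere x; V = zero_set D f; Vc = zero_set D (slice_conj D f) in
         S = {x} \<and> ((S \<subseteq> V \<and> S \<subseteq> Vc) \<or> (\<not> S \<subseteq> V \<and> \<not> S \<subseteq> Vc))))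
   \<and> (x \<in> circularization D - \<real> \<longrightarrow>
        (let S = dq_sphere x; V = zero_set D f; Vc = zero_set D (slice_conj D f);
             ds = spherical_deriv f x; vs = spherical_value f x;
             case1 = (V \<inter> S = {});
             case2 = (\<lambda>y. V \<inter> S = {y} \<and> dq_invertible ds \<and>
                        y = of_real (dq_Re x) - vs * inverse ds);
             case3 = (\<lambda>y1. y1 \<in> S \<inter> range dq_of_quat \<and> V \<inter> S = tangent_set y1 \<and>
                        ds \<in> eps_quats \<and> vs \<in> eps_quats);
             case4 = (S \<subseteq> V \<and> ds = 0 \<and> vs = 0)
         in
          (case1 \<or> (\<exists>y. case2 y) \<or> (\<exists>y1. case3 y1) \<or> case4)
        \<and> (case1 \<longrightarrow> Vc \<inter> S = {})
        \<and> (\<forall>y. case2 y \<longrightarrow> Vc \<inter> S = {dq_conjugate ds (dq_cnj y)})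
        \<and> (\<forall>y1. case3 y1 \<longrightarrow> Vc \<inter> S = tangent_set (dq_conjugate ds (dq_cnj y1)))
        \<and> (case4 \<longrightarrow> S \<subseteq> Vc)))"
proof -
  obtain F where F: "stem_function D F" "f = induced D F"
    using assms(2) unfolding slice_functions_def by blast
  define G where "G = (\<lambda>z. dqc_cnj (F z))"
  have G: "stem_function D G" "slice_conj D f = induced D G"
    using stem_function_dqc_cnj[OF F(1)] slice_conj_induced[OF assms(1) F(1)]
    by (simp_all add: G_def F(2))
  show ?thesis
  proof (rule conjI; rule impI)
    assume x: "x \<in> circularization D \<inter> \<real>"
    then obtain \<alpha> \<beta> J where J: "J \<in> dq_units"
      and ab: "Complex \<alpha> \<beta> \<in> D" "x = of_real \<alpha> + \<beta> *\<^sub>R J"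
      by (auto simp: circularization_def)
    from x obtain r where r: "x = of_real r" by (auto simp: Reals_def)
    have "of_real \<alpha> + \<beta> *\<^sub>R J = of_real r + 0 *\<^sub>R J" using r ab(2) by simp
    from dq_decomp_unique(1,3)[OF this J J] have \<beta>: "\<beta> = 0" by auto
    have "dq_sphere x = {x}"
      using J unfolding ab(2) dq_sphere_decomp[OF J] \<beta> by auto
    \<comment> \<open>At a real point the odd component of the stem function vanishes, so the two
      values are conjugate and vanish together.\<close>
    moreover have "f x = fst (F (Complex \<alpha> 0))" "slice_conj D f x = dq_cnj (fst (F (Complex \<alpha> 0)))"
      using induced_decomp[OF F(1) ab(1) J] induced_decomp[OF G(1) ab(1) J]
        stem_function_real[OF F(1)] stem_function_real[OF G(1)] ab \<beta>
      unfolding F(2)[symmetric] G(2)[symmetric] by (auto simp: G_def dqc_cnj_def)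
    ultimately show "let S = dq_sphere x; V = zero_set D f; Vc = zero_set D (slice_conj D f) in
         S = {x} \<and> ((S \<subseteq> V \<and> S \<subseteq> Vc) \<or> (\<not> S \<subseteq> V \<and> \<not> S \<subseteq> Vc))"
      using x by (simp add: Let_def zero_set_def dq_cnj_eq_0_iff)
  next
    assume x: "x \<in> circularization D - \<real>"
    then obtain \<alpha> \<beta> J where J: "J \<in> dq_units"
      and ab: "Complex \<alpha> \<beta> \<in> D" "x = of_real \<alpha> + \<beta> *\<^sub>R J"
      by (auto simp: circularization_def)
    have \<beta>: "\<beta> \<noteq> 0" using x ab(2) by auto
    define v d where vd: "v = fst (F (Complex \<alpha> \<beta>))" "d = snd (F (Complex \<alpha> \<beta>)) /\<^sub>R \<beta>"
    define g where "g = (\<lambda>y. dq_conjugate d (dq_cnj y))"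
    have S: "dq_sphere x = dq_sphere_at \<alpha> \<beta>"
      by (simp add: ab(2) dq_sphere_decomp[OF J] dq_sphere_at_def)
    have sph: "spherical_value f x = v" "spherical_deriv f x = d" "dq_Re x = \<alpha>"
      unfolding F(2) ab(2) vd by (rule spherical_decomp[OF F(1) ab(1) \<beta> J] dq_Re_decomp[OF J])+
    have V: "zero_set D f \<inter> dq_sphere_at \<alpha> \<beta> = {y \<in> dq_sphere_at \<alpha> \<beta>. v + (y - of_real \<alpha>) * d = 0}"
      unfolding F(2) vd by (rule zero_set_sphere[OF F(1) ab(1) \<beta>])
    have "fst (G (Complex \<alpha> \<beta>)) = dq_cnj v" "snd (G (Complex \<alpha> \<beta>)) /\<^sub>R \<beta> = dq_cnj d"
      by (simp_all add: G_def dqc_cnj_def vd dquat_eq_iff quat_eq_iff)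
    \<comment> \<open>All four statements about the slice conjugate are read off from this image:
      \<open>g\<close> maps the sphere onto itself and tangent sets to tangent sets.\<close>
    hence Vc: "zero_set D (slice_conj D f) \<inter> dq_sphere_at \<alpha> \<beta> = g ` (zero_set D f \<inter> dq_sphere_at \<alpha> \<beta>)"
      using zero_set_sphere[OF G(1) ab(1) \<beta>] slice_conj_zeros[of \<alpha> \<beta> v d]
      by (simp add: G(2) V g_def)
    have g: "g ` dq_sphere_at \<alpha> \<beta> = dq_sphere_at \<alpha> \<beta>"
    proof -
      have "dq_cnj ` dq_sphere_at \<alpha> \<beta> = dq_sphere_at \<alpha> \<beta>"
        by (auto intro: sphere_dq_cnj rev_image_eqI[OF sphere_dq_cnj])
      thus ?thesis unfolding g_def using sphere_dq_conjugate by (metis image_image)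
    qed
    have T: "zero_set D f \<inter> dq_sphere_at \<alpha> \<beta> = tangent_set p \<longrightarrow>
        g ` (zero_set D f \<inter> dq_sphere_at \<alpha> \<beta>) = tangent_set (dq_conjugate d (dq_cnj p))"
      if "p \<in> dq_sphere_at \<alpha> \<beta> \<inter> range dq_of_quat" "d \<in> eps_quats" for p
      using tangent_set_dq_conjugate[of p \<alpha> \<beta> d] that \<beta> by (simp add: g_def)
    have full: "dq_sphere_at \<alpha> \<beta> \<subseteq> zero_set D (slice_conj D f)" if "dq_sphere_at \<alpha> \<beta> \<subseteq> zero_set D f"
      using Vc g that by (metis inf.absorb_iff2)
    show "let S = dq_sphere x; V = zero_set D f; Vc = zero_set D (slice_conj D f);
             ds = spherical_deriv f x; vs = spherical_value f x;
             case1 = (V \<inter> S = {});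
             case2 = (\<lambda>y. V \<inter> S = {y} \<and> dq_invertible ds \<and>
                        y = of_real (dq_Re x) - vs * inverse ds);
             case3 = (\<lambda>y1. y1 \<in> S \<inter> range dq_of_quat \<and> V \<inter> S = tangent_set y1 \<and>
                        ds \<in> eps_quats \<and> vs \<in> eps_quats);
             case4 = (S \<subseteq> V \<and> ds = 0 \<and> vs = 0)
         in
          (case1 \<or> (\<exists>y. case2 y) \<or> (\<exists>y1. case3 y1) \<or> case4)
        \<and> (case1 \<longrightarrow> Vc \<inter> S = {})
        \<and> (\<forall>y. case2 y \<longrightarrow> Vc \<inter> S = {dq_conjugate ds (dq_cnj y)})
        \<and> (\<forall>y1. case3 y1 \<longrightarrow> Vc \<inter> S = tangent_set (dq_conjugate ds (dq_cnj y1)))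
        \<and> (case4 \<longrightarrow> S \<subseteq> Vc)"
      unfolding Let_def S sph Vc
    proof (intro conjI)
      show "zero_set D f \<inter> dq_sphere_at \<alpha> \<beta> = {} \<or>
        (\<exists>y. zero_set D f \<inter> dq_sphere_at \<alpha> \<beta> = {y} \<and> dq_invertible d \<and> y = of_real \<alpha> - v * inverse d) \<or>
        (\<exists>p. p \<in> dq_sphere_at \<alpha> \<beta> \<inter> range dq_of_quat \<and> zero_set D f \<inter> dq_sphere_at \<alpha> \<beta> = tangent_set p \<and>
          d \<in> eps_quats \<and> v \<in> eps_quats) \<or>
        (dq_sphere_at \<alpha> \<beta> \<subseteq> zero_set D f \<and> d = 0 \<and> v = 0)"
        using sphere_zeros_cases[OF \<beta>, of \<alpha> v d] unfolding V[symmetric] by blast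
    qed (use T full in \<open>auto simp: g_def\<close>)
  qed
qed

end
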